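(* Let $\lambda$ and $\nu$ be the birth and death rates of an irreducible, nonexplosive birth--death process on $\mathbb{N}$, and denote by $(X_t^y)_{t\ge0}$ this process started at $y\in\mathbb{N}$. Assume that the birth rate $\lambda$ is nonincreasing and that there exists $\kappa\ge0$ such that $\partial(\nu-\lambda)\ge\kappa$ on $\mathbb{N}$. Then for any $t\ge0$ and any $x\in\mathbb{N}$, the random variable $X_t^{x+1}$ is convex dominated by the independent sum of $X_t^x$ and a Bernoulli random variable $Y_t$ of parameter $e^{-\kappa t}\in(0,1]$; that is, with $Y_t$ independent of $X_t^x$, $$X_t^{x+1}\le_{\mathrm{c}}X_t^x+Y_t.$$
   Context: $\mathbb{N}=\{0,1,2,\dots\}$ and $\partial f(x)=f(x+1)-f(x)$. A birth--death process with birth rates $\lambda_x$ and death rates $\nu_x$ is the continuous-time Markov chain on $\mathbb{N}$ jumping from $x$ to $x+1$ at rate $\lambda_x$ and from $x$ to $x-1$ at rate $\nu_x$. Irreducible means $\lambda_x>0$ for all $x\in\mathbb{N}$, $\nu_x>0$ for all $x\ge1$ and $\nu_0=0$. Nonexplosive means $\sum_{x\ge1}\left(\frac1{\lambda_x}+\frac{\nu_x}{\lambda_x\lambda_{x-1}}+\cdots+\frac{\nu_x\cdots\nu_1}{\lambda_x\cdots\lambda_1\lambda_0}\right)=\infty$. Convex domination of $\mathbb{N}$-valued random variables: $X\le_{\mathrm{c}}Y$ means $\mathbb{E}[f(X)]\le\mathbb{E}[f(Y)]$ for every nonnegative nondecreasing convex function $f$ on $\mathbb{N}$, where convex means $\partial^2f=\partial(\partial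 f)\ge0$. Standing assumption: with $(P_{1,t})_{t\ge0}$ the semigroup of the birth--death process with birth rates $\lambda^1_x=\lambda_{x+1}$ and death rates $\nu^1_x=\nu_x$, and $V_1=\partial(\nu-\lambda)$, one has $P_{1,t}(\lambda^1+\nu^1+|V_1|)(x)<\infty$ for all $x\in\mathbb{N}$, $t\ge0$. *)

theory Defs
  imports "HOL-Probability.Probability"
begin

definition fdiff :: "(nat \<Rightarrow> real) \<Rightarrow> nat \<Rightarrow> real" where
  "fdiff f x = f (x + 1) - f x"

definition irreducible_rates :: "(nat \<Rightarrow> real) \<Rightarrow> (nat \<Rightarrow> real) \<Rightarrow> bool" where
  "irreducible_rates lam nu \<longleftrightarrow> (\<forall>x. 0 < lam x) \<and> (\<forall>x\<ge>1. 0 < nu x) \<and> nu 0 = 0"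

text \<open>The summand for \<open>k = x\<close> is \<open>1 / \<lambda>\<^sub>x\<close>; the one for \<open>k = 0\<close> is
  \<open>(\<nu>\<^sub>x \<cdots> \<nu>\<^sub>1) / (\<lambda>\<^sub>x \<cdots> \<lambda>\<^sub>0)\<close>. The outer sum ranges over \<open>x \<ge> 1\<close>.\<close>

definition nonexplosive_rates :: "(nat \<Rightarrow> real) \<Rightarrow> (nat \<Rightarrow> real) \<Rightarrow> bool" where
  "nonexplosive_rates lam nu \<longleftrightarrow>
     (\<Sum>n. let x = Suc n in
        ennreal (\<Sum>k\<le>x. (\<Prod>j\<in>{k<..x}. nu j) / (\<Prod>j\<in>{k..x}. lam j))) = \<infinity>"

definition bd_rate :: "(nat \<Rightarrow> real) \<Rightarrow> (nat \<Rightarrow> real) \<Rightarrow> nat \<Rightarrow> nat \<Rightarrow> real" where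
  "bd_rate lam nu x y =
     (if y = x + 1 then lam x
      else if x = y + 1 then nu x
      else if y = x then - (lam x + nu x)
      else 0)"

text \<open>Transition semigroup of the chain with jump rates \<^const>\<open>bd_rate\<close>: \<open>P t x\<close> is the law at
  time \<open>t\<close> started from \<open>x\<close>, and the rates are the right derivatives at time \<open>0\<close> of the transition
  probabilities. Since \<open>P t x\<close> is a probability (no mass is lost at infinity), this is the
  notion appropriate for nonexplosive rates, for which such a semigroup exists and is unique.\<close>

definition birth_death_semigroup ::
  "(nat \<Rightarrow> real) \<Rightarrow> (nat \<Rightarrow> real) \<Rightarrow> (real \<Rightarrow> nat \<Rightarrow> nat pmf) \<Rightarrow> bool" where
  "birth_death_semigroup lam nu P \<longleftrightarrow>
     (\<forall>x. P 0 x = return_pmf x) \<and>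
     (\<forall>s\<ge>0. \<forall>t\<ge>0. \<forall>x. P (s + t) x = bind_pmf (P s x) (P t)) \<and>
     (\<forall>x y. ((\<lambda>t. pmf (P t x) y) has_real_derivative bd_rate lam nu x y) (at_right 0))"

definition semigroup_apply ::
  "(real \<Rightarrow> nat \<Rightarrow> nat pmf) \<Rightarrow> real \<Rightarrow> (nat \<Rightarrow> real) \<Rightarrow> nat \<Rightarrow> ennreal" where
  "semigroup_apply P t f x = (\<integral>\<^sup>+ y. ennreal (f y) \<partial>measure_pmf (P t x))"

text \<open>Only times \<open>t \<ge> 0\<close> are relevant; \<open>X t\<close> is unconstrained for negative \<open>t\<close>.\<close>

definition markov_process ::
  "(real \<Rightarrow> nat \<Rightarrow> nat pmf) \<Rightarrow> nat \<Rightarrow> 'a measure \<Rightarrow> (real \<Rightarrow> 'a \<Rightarrow> nat) \<Rightarrow> bool" where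
  "markov_process P y M X \<longleftrightarrow>
     prob_space M \<and>
     (\<forall>t\<ge>0. X t \<in> measurable M (count_space UNIV)) \<and>
     (AE \<omega> in M. X 0 \<omega> = y) \<and>
     (AE \<omega> in M. \<forall>t\<ge>0. continuous (at_right t) (\<lambda>s. X s \<omega>)) \<and>
     (\<forall>n (s :: nat \<Rightarrow> real) (z :: nat \<Rightarrow> nat).
        0 \<le> s 0 \<longrightarrow> (\<forall>k\<le>n. s k \<le> s (Suc k)) \<longrightarrow>
        \<P>(\<omega> in M. \<forall>k\<le>n. X (s k) \<omega> = z k) \<noteq> 0 \<longrightarrow>
        \<P>(\<omega> in M. X (s (Suc n)) \<omega> = z (Suc n) \<bar> \<forall>k\<le>n. X (s k) \<omega> = z k)
          = pmf (P (s (Suc n) - s n) (z n)) (z (Suc n)))"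

definition birth_death_process ::
  "(nat \<Rightarrow> real) \<Rightarrow> (nat \<Rightarrow> real) \<Rightarrow> nat \<Rightarrow> 'a measure \<Rightarrow> (real \<Rightarrow> 'a \<Rightarrow> nat) \<Rightarrow> bool" where
  "birth_death_process lam nu y M X \<longleftrightarrow>
     (\<exists>P. birth_death_semigroup lam nu P \<and> markov_process P y M X)"

text \<open>The two random variables may live on different probability spaces. The expectations of the
  nonnegative test functions are taken in \<open>[0, \<infinity>]\<close>.\<close>

definition convex_dominated :: "'a measure \<Rightarrow> ('a \<Rightarrow> nat) \<Rightarrow> 'b measure \<Rightarrow> ('b \<Rightarrow> nat) \<Rightarrow> bool" where
  "convex_dominated M X N Y \<longleftrightarrow>
     (\<forall>f :: nat \<Rightarrow> real. (\<forall>x. 0 \<le> f x) \<longrightarrow> mono f \<longrightarrow> (\<forall>x. 0 \<le> fdiff (fdiff f) x) \<longrightarrow>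
        (\<integral>\<^sup>+ \<omega>. ennreal (f (X \<omega>)) \<partial>M) \<le> (\<integral>\<^sup>+ \<omega>. ennreal (f (Y \<omega>)) \<partial>N))"

end

theory Submission
  imports Defs
begin

text \<open>
  Write \<open>P\<^sub>t\<close> for the semigroup, \<open>L v x = \<lambda>\<^sub>x \<partial>v(x) - \<nu>\<^sub>x \<partial>v(x - 1)\<close> for its generator and
  \<open>V = \<partial>(\<nu> - \<lambda>) \<ge> \<kappa>\<close>. Since \<open>Y\<^sub>t\<close> is Bernoulli and independent, the expectation of
  \<open>f(X\<^sub>t + Y\<^sub>t)\<close> started from \<open>x\<close> is \<open>P\<^sub>t f(x) + e\<^sup>-\<^sup>\<kappa>\<^sup>t P\<^sub>t(\<partial>f)(x)\<close>, so the claim is the commutation inequality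
  \<open>\<partial>P\<^sub>t f \<le> e\<^sup>-\<^sup>\<kappa>\<^sup>t P\<^sub>t \<partial>f\<close> for nondecreasing convex \<open>f\<close>.

  Differencing intertwines generators: \<open>\<partial>(L u) = L\<^sub>1(\<partial>u) - V \<partial>u\<close>, where \<open>L\<^sub>1\<close> is the generator with
  birth rates \<open>\<lambda>\<^sub>x\<^sub>+\<^sub>1\<close> and death rates \<open>\<nu>\<^sub>x\<close> (\<open>generator_intertwining\<close>). Hence \<open>g = \<partial>P\<^sub>t f\<close> solves
  \<open>g' = L\<^sub>1 g - V g\<close>. On the other side, \<open>H = e\<^sup>-\<^sup>\<kappa>\<^sup>t P\<^sub>t h\<close> solves \<open>H' = L H - \<kappa> H\<close>, and
  \<open>L H - \<kappa> H = (L\<^sub>1 H - V H) + (\<lambda>\<^sub>x - \<lambda>\<^sub>x\<^sub>+\<^sub>1) \<partial>H + (V - \<kappa>) H\<close>. The last two terms are nonnegative when \<open>h\<close> is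
  nonnegative and nondecreasing, because \<open>P\<^sub>t\<close> preserves monotonicity (\<open>semigroup_mono\<close>). So
  \<open>H - g\<close> is a supersolution of the equation of \<open>g\<close>; if \<open>\<partial>f \<le> h\<close> it starts nonnegative and a minimum
  principle keeps it so (\<open>difference_semigroup_le\<close>).

  The minimum principle (\<open>minimum_principle\<close>) applies to functions bounded below. As \<open>\<lambda>\<close> is
  nonincreasing, birth rates are bounded and \<open>x + 1\<close> grows at most linearly in time under the
  dynamics, however large the death rates are; a small multiple of it forces the minimum over
  space to be attained. To stay with bounded functions, \<open>f\<close> is replaced by \<open>f(min x m)\<close>, whose
  differences are bounded by the bounded nondecreasing function \<open>\<partial>f(min x m)\<close>, and \<open>m\<close> tends to
  infinity by monotone convergence (\<open>semigroup_convex_step\<close>).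

  The two processes of the theorem come with a priori different semigroups; the same minimum
  principle shows that they agree (\<open>semigroup_unique\<close>).
\<close>

section \<open>A minimum principle for birth-death generators\<close>

definition bd_generator :: "(nat \<Rightarrow> real) \<Rightarrow> (nat \<Rightarrow> real) \<Rightarrow> (nat \<Rightarrow> real) \<Rightarrow> nat \<Rightarrow> real" where
  "bd_generator b d v x = b x * (v (x + 1) - v x) + d x * (v (x - 1) - v x)"

text \<open>
  After adding \<open>\<epsilon> (x + 1 + (A + 1) t)\<close>, a strict supersolution by the bound \<open>A\<close> on the birth rates,
  only finitely many sites can become negative. At the last instant before this happens the
  function is nonnegative everywhere, so at a site where it vanishes the generator is
  nonnegative and the right derivative positive: the function stays nonnegative a little
  longer, a contradiction. This uses one-sided derivatives only, which is what the
  semigroup property yields directly.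
\<close>

lemma minimum_principle:
  fixes b d c :: "nat \<Rightarrow> real" and w D :: "real \<Rightarrow> nat \<Rightarrow> real"
  assumes rates: "\<And>x. 0 \<le> b x" "\<And>x. 0 \<le> d x" "\<And>x. 0 \<le> c x"
    and birth_bounded: "\<And>x. b x \<le> A"
    and continuous: "\<And>x. continuous_on {0..} (\<lambda>t. w t x)"
    and deriv: "\<And>t x. 0 \<le> t \<Longrightarrow> ((\<lambda>s. w s x) has_real_derivative D t x) (at_right t)"
    and super: "\<And>t x. 0 \<le> t \<Longrightarrow> bd_generator b d (w t) x - c x * w t x \<le> D t x"
    and below: "\<And>t x. 0 \<le> t \<Longrightarrow> - B \<le> w t x"
    and init: "\<And>x. 0 \<le> w 0 x"
    and "0 \<le> t"
  shows "0 \<le> w t x"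
proof -
  have A: "0 \<le> A" using rates(1) birth_bounded order_trans by blast
  have perturbed: "0 \<le> w t x + \<epsilon> * (real x + 1 + (A + 1) * t)" 
    if \<epsilon>: "0 < \<epsilon>" and "0 \<le> t" for \<epsilon> t x
  proof -
    define \<phi> where "\<phi> s y = real y + 1 + (A + 1) * s" for s :: real and y
    define W where "W s y = w s y + \<epsilon> * \<phi> s y" for s y
    have \<phi>_pos: "0 < \<phi> s y" if "0 \<le> s" for s y
      using that A unfolding \<phi>_def
      by (intro add_pos_nonneg[OF add_nonneg_pos]) auto
    have W_cont: "continuous_on {0..} (\<lambda>s. W s y)" for y
      unfolding W_def \<phi>_def by (intro continuous_intros continuous)
    have W_deriv: "((\<lambda>s. W s y) has_real_derivative D s y + \<epsilon> * (A + 1)) (at_right s)"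
      if "0 \<le> s" for s y
      unfolding W_def \<phi>_def by (auto intro!: derivative_eq_intros deriv that)
    \<comment> \<open>From the site \<open>R\<close> on, the term \<open>\<epsilon> x\<close> outweighs the lower bound \<open>- B\<close>.\<close>
    define R where "R = nat \<lceil>B / \<epsilon>\<rceil>"
    have W_large: "0 \<le> W s y" if "0 \<le> s" "R \<le> y" for s y
    proof -
      have "B / \<epsilon> \<le> real y" using that(2) unfolding R_def by linarith
      hence "B \<le> \<epsilon> * real y" using \<epsilon> by (simp add: field_simps)
      also have "\<dots> \<le> \<epsilon> * \<phi> s y" using \<epsilon> A that(1) unfolding \<phi>_def by (intro mult_left_mono) auto
      finally show ?thesis using below[OF that(1), of y] unfolding W_def by simp
    qed
    have later: "eventually (\<lambda>s. 0 \<le> W s y) (at_right r)"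
      if r: "0 \<le> r" and Wr: "\<And>y. 0 \<le> W r y" for r y
    proof (cases "W r y = 0")
      case False
      hence "0 < W r y" using Wr[of y] by simp
      moreover have "((\<lambda>s. W s y) \<longlongrightarrow> W r y) (at_right r)"
        using DERIV_continuous[OF W_deriv[OF r]] by (simp add: continuous_within)
      ultimately have "eventually (\<lambda>s. 0 < W s y) (at_right r)"
        by (simp add: order_tendstoD)
      thus ?thesis by eventually_elim simp
    next
      case True
      have "0 \<le> bd_generator b d (W r) y - c y * W r y"
        unfolding bd_generator_def True using rates(1,2)[of y] Wr by (simp add: add_nonneg_nonneg)
      also have "\<dots> = bd_generator b d (w r) y - c y * w r y
          + \<epsilon> * (bd_generator b d (\<phi> r) y - c y * \<phi> r y)"
        unfolding W_def bd_generator_def by (simp add: algebra_simps)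
      also have "\<dots> \<le> D r y + \<epsilon> * A"
      proof (intro add_mono mult_left_mono super r)
        have "d y * (\<phi> r (y - 1) - \<phi> r y) \<le> 0"
          using rates(2)[of y] by (intro mult_nonneg_nonpos) (auto simp: \<phi>_def)
        moreover have "b y * (\<phi> r (y + 1) - \<phi> r y) \<le> A"
          using birth_bounded[of y] by (simp add: \<phi>_def)
        moreover have "0 \<le> c y * \<phi> r y" using rates(3)[of y] \<phi>_pos[OF r, of y] by simp
        ultimately show "bd_generator b d (\<phi> r) y - c y * \<phi> r y \<le> A"
          unfolding bd_generator_def by linarith
      qed (use \<epsilon> in simp)
      finally have "0 < D r y + \<epsilon> * (A + 1)" using \<epsilon> by (simp add: algebra_simps)
      from has_real_derivative_pos_inc_right[OF W_deriv[OF r] this]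
      obtain e where "0 < e" "\<And>h. 0 < h \<Longrightarrow> h < e \<Longrightarrow> W r y < W (r + h) y" by auto
      hence "\<forall>s>r. s < r + e \<longrightarrow> 0 \<le> W s y"
        using True by (metis add_diff_cancel_left' add_less_cancel_left diff_add_cancel
            diff_gt_0_iff_gt less_eq_real_def add.commute)
      thus ?thesis using \<open>0 < e\<close> unfolding eventually_at_right_field
        by (intro exI[of _ "r + e"]) auto
    qed
    have "0 \<le> W t x"
    proof (rule ccontr)
      define S where "S = {s. 0 \<le> s \<and> (\<exists>y. W s y < 0)}"
      assume "\<not> 0 \<le> W t x"
      hence S: "S \<noteq> {}" "bdd_below S" using \<open>0 \<le> t\<close> not_le unfolding S_def by (blast, auto intro: bdd_belowI[of _ 0])
      define r where "r = Inf S"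
      have r: "0 \<le> r" unfolding r_def using S by (intro cInf_greatest) (auto simp: S_def)
      have before: "0 \<le> W s y" if "0 \<le> s" "s < r" for s y
      proof (rule ccontr)
        assume "\<not> 0 \<le> W s y"
        hence "s \<in> S" using that(1) not_le unfolding S_def by blast
        thus False using cInf_lower[OF _ S(2), of s] that(2) unfolding r_def by simp
      qed
      have at_r: "0 \<le> W r y" for y
      proof (cases "r = 0")
        case True
        thus ?thesis using init[of y] \<phi>_pos[of 0 y] \<epsilon> unfolding W_def by simp
      next
        case False
        hence "0 < r" using r by simp
        have "((\<lambda>s. W s y) \<longlongrightarrow> W r y) (at r within {0..})"
          using W_cont[of y] r unfolding continuous_on_def by simp
        hence "((\<lambda>s. W s y) \<longlongrightarrow> W r y) (at r)"
          using at_within_interior[of r "{0..}"] \<open>0 < r\<close> by (simp add: interior_real_atLeast)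
        hence "((\<lambda>s. W s y) \<longlongrightarrow> W r y) (at_left r)"
          by (rule filterlim_mono) (auto simp: at_within_le_at)
        moreover have "eventually (\<lambda>s. 0 \<le> W s y) (at_left r)"
          unfolding eventually_at_left_field using \<open>0 < r\<close> before by (intro exI[of _ 0]) auto
        ultimately show ?thesis by (intro tendsto_lowerbound) auto
      qed
      have "eventually (\<lambda>s. \<forall>y\<in>{..<R}. 0 \<le> W s y) (at_right r)"
        by (intro eventually_ball_finite) (auto intro: later r at_r)
      then obtain e where e: "r < e" "\<And>s y. r < s \<Longrightarrow> s < e \<Longrightarrow> y < R \<Longrightarrow> 0 \<le> W s y"
        unfolding eventually_at_right_field by auto
      have "e \<le> s" if s: "s \<in> S" for s
      proof (rule ccontr)
        assume "\<not> e \<le> s"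
        moreover obtain y where y: "W s y < 0" "0 \<le> s" using s unfolding S_def by auto
        moreover have "r \<le> s" unfolding r_def using s S by (intro cInf_lower)
        moreover have "y < R" using W_large[of s y] y by fastforce
        ultimately show False using e(2)[of s y] at_r[of y] by (cases "s = r") auto
      qed
      hence "e \<le> r" unfolding r_def using S by (intro cInf_greatest)
      thus False using e(1) by simp
    qed
    thus ?thesis unfolding W_def \<phi>_def .
  qed
  have "((\<lambda>\<epsilon>. w t x + \<epsilon> * (real x + 1 + (A + 1) * t)) \<longlongrightarrow> w t x + 0 * (real x + 1 + (A + 1) * t))
      (at_right 0)"
    by (intro tendsto_intros)
  moreover have "eventually (\<lambda>\<epsilon>. 0 \<le> w t x + \<epsilon> * (real x + 1 + (A + 1) * t)) (at_right 0)"
    unfolding eventually_at_right_field using perturbed \<open>0 \<le> t\<close> by (intro exI[of _ 1]) auto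
  ultimately have "0 \<le> w t x + 0 * (real x + 1 + (A + 1) * t)"
    by (intro tendsto_lowerbound) auto
  thus ?thesis by simp
qed

section \<open>Backward equation for bounded functions\<close>

abbreviation expect :: "nat pmf \<Rightarrow> (nat \<Rightarrow> real) \<Rightarrow> real" where
  "expect p f \<equiv> measure_pmf.expectation p f"

lemma integrable_bounded_pmf:
  fixes f :: "nat \<Rightarrow> real"
  assumes "\<And>y. \<bar>f y\<bar> \<le> B"
  shows "integrable (measure_pmf p) f"
  by (rule measure_pmf.integrable_const_bound[where B = B]) (use assms in auto)

lemma abs_expect_le:
  fixes f :: "nat \<Rightarrow> real"
  assumes "\<And>y. \<bar>f y\<bar> \<le> B"
  shows "\<bar>expect p f\<bar> \<le> B"
proof -
  have "\<bar>expect p f\<bar> \<le> expect p (\<lambda>y. \<bar>f y\<bar>)" by (rule integral_abs_bound)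
  also have "\<dots> \<le> expect p (\<lambda>_. B)"
    by (intro integral_mono integrable_abs integrable_bounded_pmf[OF assms]) (use assms in auto)
  finally show ?thesis by simp
qed

text \<open>Shifting \<open>f\<close> by \<open>B\<close> makes it nonnegative and reduces the claim to the Lebesgue integral
  on \<open>[0, \<infinity>]\<close>.\<close>

lemma expect_bind_pmf:
  fixes f :: "nat \<Rightarrow> real"
  assumes f: "\<And>y. \<bar>f y\<bar> \<le> B"
  shows "expect (bind_pmf p q) f = expect p (\<lambda>y. expect (q y) f)"
proof -
  have nn: "(\<integral>\<^sup>+ y. ennreal (f y + B) \<partial>r) = ennreal (expect r f + B)" for r :: "nat pmf"
  proof -
    have "0 \<le> f y + B" for y using f[of y] by linarith
    hence "(\<integral>\<^sup>+ y. ennreal (f y + B) \<partial>r) = ennreal (expect r (\<lambda>y. f y + B))"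
      by (intro nn_integral_eq_integral) (auto intro: integrable_bounded_pmf[OF f])
    thus ?thesis using integrable_bounded_pmf[OF f] by simp
  qed
  have g: "\<bar>expect (q y) f\<bar> \<le> B" for y by (rule abs_expect_le[OF f])
  have g': "0 \<le> expect (q y) f + B" for y using g[of y] by linarith
  have "ennreal (expect (bind_pmf p q) f + B) = (\<integral>\<^sup>+ y. ennreal (expect (q y) f + B) \<partial>p)"
    unfolding nn[symmetric] by simp
  also have "\<dots> = ennreal (expect p (\<lambda>y. expect (q y) f + B))"
    using g' by (intro nn_integral_eq_integral) (auto intro: integrable_bounded_pmf[OF g])
  also have "\<dots> = ennreal (expect p (\<lambda>y. expect (q y) f) + B)"
    using integrable_bounded_pmf[OF g] by simp
  finally show ?thesis
    using abs_expect_le[where f = f and p = "bind_pmf p q", OF f]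
      abs_expect_le[where f = "\<lambda>y. expect (q y) f" and p = p, OF g]
    by (subst (asm) ennreal_inj) (auto simp: abs_le_iff)
qed

lemma sum_bd_rate:
  assumes "nu 0 = 0"
  shows "(\<Sum>y\<le>x + 1. bd_rate lam nu x y * v y) = bd_generator lam nu v x"
proof (cases x)
  case 0
  thus ?thesis using assms by (simp add: bd_rate_def bd_generator_def algebra_simps)
next
  case (Suc n)
  have "(\<Sum>y<n. bd_rate lam nu x y * v y) = 0"
    by (intro sum.neutral) (auto simp: bd_rate_def Suc)
  thus ?thesis
    by (simp add: Suc lessThan_Suc_atMost[symmetric] bd_rate_def bd_generator_def algebra_simps)
qed

text \<open>
  Only the convergence of each transition probability is given, and the expectation involves
  infinitely many of them. The rates out of \<open>x\<close> sum to zero over the finite set of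
  sites \<open>y \<le> x + 1\<close>, so the mass outside this set is \<open>o(s)\<close> and contributes nothing to the derivative.
\<close>

lemma semigroup_right_derivative_0:
  assumes P: "birth_death_semigroup lam nu P" and nu0: "nu 0 = 0"
    and v: "\<And>y. \<bar>v y\<bar> \<le> B"
  shows "((\<lambda>s. expect (P s x) v) has_real_derivative bd_generator lam nu v x) (at_right 0)"
proof -
  define F where "F = {..x + 1}"
  have rate: "((\<lambda>s. pmf (P s x) y) has_real_derivative bd_rate lam nu x y) (at_right 0)" for y
    using P by (simp add: birth_death_semigroup_def)
  have P0: "P 0 x = return_pmf x" using P by (simp add: birth_death_semigroup_def)
  define near where "near u s = (\<Sum>y\<in>F. pmf (P s x) y * u y)" for u :: "nat \<Rightarrow> real" and s
  define far where "far s = expect (P s x) (\<lambda>y. v y * indicator (- F) y)" for s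
  have near_deriv: "(near u has_real_derivative bd_generator lam nu u x) (at_right 0)" for u
    unfolding near_def sum_bd_rate[where nu = nu and x = x, OF nu0, symmetric] F_def
    by (auto intro!: derivative_eq_intros rate)
  have near_eq: "near u s = expect (P s x) (\<lambda>y. u y * indicator F y)" for u s
    unfolding near_def F_def
    by (subst integral_measure_pmf_real[where A = "{..x + 1}"])
      (auto simp: indicator_def mult.commute intro!: sum.cong split: if_splits)
  have int: "integrable (P s x) (\<lambda>y. u y * indicator G y)" if "\<And>y. \<bar>u y\<bar> \<le> C"
    for u :: "nat \<Rightarrow> real" and G s C
    using that by (intro integrable_bounded_pmf[where B = "\<bar>C\<bar>"]) (auto simp: indicator_def intro: order_trans[OF that])
  have split: "expect (P s x) v = near v s + far s" for s
  proof -
    have "v y = v y * indicator F y + v y * indicator (- F) y" for y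
      by (simp add: indicator_def)
    hence "expect (P s x) v = expect (P s x) (\<lambda>y. v y * indicator F y + v y * indicator (- F) y)"
      by presburger
    thus ?thesis unfolding near_eq far_def
      using int[where u = v, OF v] by simp
  qed
  have far_bound: "\<bar>far s\<bar> \<le> B * (1 - near (\<lambda>_. 1) s)" for s
  proof -
    have "\<bar>far s\<bar> \<le> expect (P s x) (\<lambda>y. \<bar>v y * indicator (- F) y\<bar>)"
      unfolding far_def by (rule integral_abs_bound)
    also have "\<dots> \<le> expect (P s x) (\<lambda>y. B * (1 - 1 * indicator F y))"
    proof (rule integral_mono)
      show "integrable (P s x) (\<lambda>y. \<bar>v y * indicator (- F) y\<bar>)"
        by (intro integrable_abs int[OF v])
      show "integrable (P s x) (\<lambda>y. B * (1 - 1 * indicator F y))"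
        by (intro integrable_mult_right Bochner_Integration.integrable_diff int[where C = 1]) auto
      show "\<bar>v y * indicator (- F) y\<bar> \<le> B * (1 - 1 * indicator F y)" for y
        using v[of y] by (simp add: indicator_def)
    qed
    also have "\<dots> = B * (1 - near (\<lambda>_. 1) s)"
      unfolding near_eq using int[of "\<lambda>_. 1" 1 s F]
      by (subst Bochner_Integration.integral_mult_right_zero,
          subst Bochner_Integration.integral_diff) auto
    finally show ?thesis .
  qed
  have near_0: "near (\<lambda>_. 1) 0 = 1"
    unfolding near_eq P0 by (simp add: F_def)
  have "far 0 = 0" using far_bound[of 0] near_0 by simp
  have "((\<lambda>s. B * (1 - near (\<lambda>_. 1) s)) has_real_derivative 0) (at_right 0)"
    by (rule derivative_eq_intros near_deriv refl)+ (simp add: bd_generator_def)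
  hence "((\<lambda>s. B * (1 - near (\<lambda>_. 1) s) / s) \<longlongrightarrow> 0) (at_right 0)"
    by (simp add: has_field_derivative_iff near_0)
  hence "((\<lambda>s. far s / s) \<longlongrightarrow> 0) (at_right 0)"
  proof (rule Lim_null_comparison[rotated])
    show "\<forall>\<^sub>F s in at_right 0. norm (far s / s) \<le> B * (1 - near (\<lambda>_. 1) s) / s"
      unfolding eventually_at_right_field using far_bound
      by (intro exI[of _ 1]) (auto simp: divide_right_mono)
  qed
  hence "(far has_real_derivative 0) (at_right 0)"
    by (simp add: has_field_derivative_iff \<open>far 0 = 0\<close>)
  from DERIV_add[OF near_deriv[of v] this] show ?thesis by (simp add: split)
qed

lemma expect_semigroup_add:
  assumes P: "birth_death_semigroup lam nu P" and v: "\<And>y. \<bar>v y\<bar> \<le> B"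
    and "0 \<le> s" "0 \<le> t"
  shows "expect (P (t + s) x) v = expect (P s x) (\<lambda>y. expect (P t y) v)"
proof -
  have "P (s + t) x = bind_pmf (P s x) (P t)"
    using P assms(3,4) by (simp add: birth_death_semigroup_def)
  thus ?thesis by (simp add: add.commute expect_bind_pmf[OF v])
qed

lemma expect_semigroup_0:
  assumes "birth_death_semigroup lam nu P"
  shows "expect (P 0 x) v = v x"
  using assms by (simp add: birth_death_semigroup_def)

text \<open>The backward form conditions on the first short time step, \<open>P\<^sub>t\<^sub>+\<^sub>s v = P\<^sub>s (P\<^sub>t v)\<close>, so that the
  derivative at time \<open>0\<close> is applied to the bounded function \<open>P\<^sub>t v\<close>.\<close>

lemma backward_equation:
  assumes P: "birth_death_semigroup lam nu P" and nu0: "nu 0 = 0"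
    and v: "\<And>y. \<bar>v y\<bar> \<le> B" and t: "0 \<le> t"
  shows "((\<lambda>s. expect (P s x) v) has_real_derivative
            bd_generator lam nu (\<lambda>y. expect (P t y) v) x) (at_right t)"
proof -
  let ?u = "\<lambda>y. expect (P t y) v"
  have "((\<lambda>s. expect (P s x) ?u) has_real_derivative bd_generator lam nu ?u x) (at_right 0)"
    by (rule semigroup_right_derivative_0[OF P nu0 abs_expect_le[OF v]])
  hence "((\<lambda>s. (expect (P s x) ?u - ?u x) / s) \<longlongrightarrow> bd_generator lam nu ?u x) (at_right 0)"
    by (simp add: has_field_derivative_iff expect_semigroup_0[OF P])
  hence "((\<lambda>s. (expect (P (s + t) x) v - ?u x) / (s + t - t)) \<longlongrightarrow> bd_generator lam nu ?u x) (at_right 0)"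
  proof (rule Lim_transform_eventually)
    show "\<forall>\<^sub>F s in at_right 0. (expect (P s x) ?u - ?u x) / s
        = (expect (P (s + t) x) v - ?u x) / (s + t - t)"
      unfolding eventually_at_right_field
      by (intro exI[of _ 1]) (auto simp: add.commute[of _ t] expect_semigroup_add[OF P v _ t])
  qed
  thus ?thesis unfolding has_field_derivative_iff filterlim_at_right_to_0[of _ _ t] by simp
qed

text \<open>The increment over a time step \<open>s\<close> is at most \<open>2 B\<close> times the probability that the
  process started at \<open>x\<close> is elsewhere at time \<open>s\<close>. This bound is uniform in the starting time, which gives continuity
  from the left as well.\<close>

lemma semigroup_continuous_on:
  assumes P: "birth_death_semigroup lam nu P" and v: "\<And>y. \<bar>v y\<bar> \<le> B"
  shows "continuous_on {0..} (\<lambda>t. expect (P t x) v)"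
proof -
  have increment: "\<bar>expect (P (t + s) x) v - expect (P t x) v\<bar> \<le> 2 * B * (1 - pmf (P s x) x)"
    if "0 \<le> s" "0 \<le> t" for s t
  proof -
    let ?u = "\<lambda>y. expect (P t y) v"
    have u: "\<bar>?u y\<bar> \<le> B" for y by (rule abs_expect_le[OF v])
    have i: "integrable (P s x) (\<lambda>y. ?u y - ?u x)"
      using integrable_bounded_pmf[OF u] by (intro Bochner_Integration.integrable_diff) auto
    have "expect (P (t + s) x) v - expect (P t x) v = expect (P s x) (\<lambda>y. ?u y - ?u x)"
      using integrable_bounded_pmf[OF u] expect_semigroup_add[OF P v that, of x] by simp
    hence "\<bar>expect (P (t + s) x) v - expect (P t x) v\<bar> \<le> expect (P s x) (\<lambda>y. \<bar>?u y - ?u x\<bar>)"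
      using integral_abs_bound[of "P s x" "\<lambda>y. ?u y - ?u x"] by simp
    also have "\<dots> \<le> expect (P s x) (\<lambda>y. 2 * B * (1 - indicator {x} y))"
    proof (intro integral_mono integrable_abs i)
      show "integrable (P s x) (\<lambda>y. 2 * B * (1 - indicator {x} y))"
        by (intro integrable_bounded_pmf[where B = "\<bar>2 * B\<bar>"]) (auto simp: indicator_def)
      show "\<bar>?u y - ?u x\<bar> \<le> 2 * B * (1 - indicator {x} y)" for y
        using u[of x] u[of y] by (auto simp: indicator_def)
    qed
    also have "\<dots> = 2 * B * (1 - pmf (P s x) x)"
      using integrable_bounded_pmf[of "indicator {x}" 1 "P s x"]
      by (simp add: measure_pmf_single indicator_le_1)
    finally show ?thesis .
  qed
  define \<delta> where "\<delta> s = 2 * B * (1 - pmf (P s x) x)" for s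
  have rate: "((\<lambda>s. pmf (P s x) x) has_real_derivative bd_rate lam nu x x) (at_right 0)"
    using P by (simp add: birth_death_semigroup_def)
  have P0: "P 0 x = return_pmf x" using P by (simp add: birth_death_semigroup_def)
  have "((\<lambda>s. pmf (P s x) x) \<longlongrightarrow> 1) (at_right 0)"
    using DERIV_continuous[OF rate] by (simp add: continuous_within P0)
  hence "(\<delta> \<longlongrightarrow> 2 * B * (1 - 1)) (at_right 0)"
    unfolding \<delta>_def by (intro tendsto_intros)
  hence \<delta>: "(\<delta> \<longlongrightarrow> 0) (at_right 0)" by simp
  show ?thesis
    unfolding continuous_on_iff
  proof (intro ballI allI impI)
    fix t e :: real assume "t \<in> {0..}" "0 < e"
    have "eventually (\<lambda>s. \<bar>\<delta> s\<bar> < e) (at_right 0)"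
      using tendstoD[OF \<delta> \<open>0 < e\<close>] by simp
    then obtain h where h: "0 < h" "\<And>s. 0 < s \<Longrightarrow> s < h \<Longrightarrow> \<bar>\<delta> s\<bar> < e"
      unfolding eventually_at_right_field by auto
    have *: "\<bar>expect (P r' x) v - expect (P r x) v\<bar> < e"
      if "0 \<le> r" "r < r'" "r' - r < h" for r r'
      using increment[of "r' - r" r] h(2)[of "r' - r"] that by (simp add: \<delta>_def)
    show "\<exists>h>0. \<forall>t'\<in>{0..}. dist t' t < h \<longrightarrow> dist (expect (P t' x) v) (expect (P t x) v) < e"
    proof (intro exI[of _ h] conjI ballI impI h(1))
      fix t' assume "t' \<in> {0..}" "dist t' t < h"
      thus "dist (expect (P t' x) v) (expect (P t x) v) < e"
        using *[of t t'] *[of t' t] \<open>t \<in> {0..}\<close> \<open>0 < e\<close>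
        by (cases t' t rule: linorder_cases) (auto simp: dist_real_def abs_minus_commute)
    qed
  qed
qed


section \<open>Uniqueness, monotonicity and the commutation inequality\<close>

lemma irreducible_ratesD:
  assumes "irreducible_rates lam nu"
  shows "nu 0 = 0" and "0 \<le> lam x" and "0 \<le> nu x"
proof -
  show "nu 0 = 0" using assms by (simp add: irreducible_rates_def)
  show "0 \<le> lam x" using assms by (simp add: irreducible_rates_def less_imp_le)
  show "0 \<le> nu x" using assms by (cases "x = 0") (auto simp: irreducible_rates_def intro: less_imp_le)
qed

text \<open>The difference of two bounded solutions of the backward equation with equal initial values
  is nonnegative by the minimum principle, in either order.\<close>

lemma semigroup_unique:
  assumes P: "birth_death_semigroup lam nu P" and Q: "birth_death_semigroup lam nu Q"
    and rates: "irreducible_rates lam nu" and birth_bounded: "\<And>x. lam x \<le> A"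
    and t: "0 \<le> t"
  shows "P t x = Q t x"
proof -
  note nu0 = irreducible_ratesD(1)[OF rates] and pos = irreducible_ratesD(2,3)[OF rates]
  have le: "expect (P t x) v \<le> expect (Q t x) v"
    if P: "birth_death_semigroup lam nu P" and Q: "birth_death_semigroup lam nu Q"
      and v: "\<And>y. \<bar>v y\<bar> \<le> B" for P Q v B
  proof -
    have "0 \<le> expect (Q t x) v - expect (P t x) v"
    proof (rule minimum_principle[where w = "\<lambda>s y. expect (Q s y) v - expect (P s y) v" and t = t and x = x
          and b = lam and d = nu and c = "\<lambda>_. 0" and A = A and B = "2 * B"
          and D = "\<lambda>t y. bd_generator lam nu (\<lambda>z. expect (Q t z) v) y
                    - bd_generator lam nu (\<lambda>z. expect (P t z) v) y"])
      show "- (2 * B) \<le> expect (Q s y) v - expect (P s y) v" for s y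
        using abs_expect_le[where f = v and p = "P s y", OF v]
          abs_expect_le[where f = v and p = "Q s y", OF v]
        by linarith
      show "continuous_on {0..} (\<lambda>s. expect (Q s y) v - expect (P s y) v)" for y
        by (intro continuous_on_diff semigroup_continuous_on[OF P v] semigroup_continuous_on[OF Q v])
      show "((\<lambda>s. expect (Q s y) v - expect (P s y) v) has_real_derivative
          bd_generator lam nu (\<lambda>z. expect (Q s z) v) y
          - bd_generator lam nu (\<lambda>z. expect (P s z) v) y) (at_right s)" if "0 \<le> s" for s y
        by (intro DERIV_diff backward_equation[OF P nu0 v that] backward_equation[OF Q nu0 v that])
      show "bd_generator lam nu (\<lambda>z. expect (Q s z) v - expect (P s z) v) y
          - 0 * (expect (Q s y) v - expect (P s y) v)
        \<le> bd_generator lam nu (\<lambda>z. expect (Q s z) v) y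
          - bd_generator lam nu (\<lambda>z. expect (P s z) v) y" for s y
        by (simp add: bd_generator_def algebra_simps)
    qed (simp_all add: pos birth_bounded t expect_semigroup_0[OF P] expect_semigroup_0[OF Q])
    thus ?thesis by simp
  qed
  show ?thesis
  proof (rule pmf_eqI)
    fix y :: nat
    have "\<bar>indicator {y} z :: real\<bar> \<le> 1" for z by (simp add: indicator_def)
    hence "expect (P t x) (indicator {y}) = expect (Q t x) (indicator {y})"
      by (intro antisym le[OF P Q] le[OF Q P])
    thus "pmf (P t x) y = pmf (Q t x) y" by (simp add: measure_pmf_single)
  qed
qed

text \<open>The operator acting on \<open>\<partial>u\<close> is again a birth-death generator, with shifted birth rates and
  with a potential that amounts to killing at rate \<open>\<partial>(\<nu> - \<lambda>)\<close> when this is nonnegative. In that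
  case the equation for \<open>\<partial>P\<^sub>t f\<close> obeys the minimum principle.\<close>

lemma generator_intertwining:
  assumes "nu 0 = 0"
  shows "fdiff (bd_generator lam nu u) x
    = bd_generator (\<lambda>y. lam (y + 1)) nu (fdiff u) x - fdiff (\<lambda>y. nu y - lam y) x * fdiff u x"
proof -
  have "nu x * u (x - 1 + 1) = nu x * u x" using assms by (cases x) simp_all
  thus ?thesis unfolding bd_generator_def fdiff_def add_diff_cancel_right' by algebra
qed

text \<open>\<open>\<partial>P\<^sub>t h\<close> solves the killed equation exactly and starts from \<open>\<partial>h \<ge> 0\<close>.\<close>

lemma semigroup_mono:
  assumes P: "birth_death_semigroup lam nu P"
    and rates: "irreducible_rates lam nu" and birth_bounded: "\<And>x. lam x \<le> A"
    and curvature: "\<And>y. 0 \<le> fdiff (\<lambda>w. nu w - lam w) y"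
    and h: "\<And>y. \<bar>h y\<bar> \<le> B" "mono h" and t: "0 \<le> t"
  shows "0 \<le> fdiff (\<lambda>y. expect (P t y) h) x"
proof -
  note nu0 = irreducible_ratesD(1)[OF rates] and pos = irreducible_ratesD(2,3)[OF rates]
  show ?thesis
  proof (rule minimum_principle[where w = "\<lambda>s. fdiff (\<lambda>y. expect (P s y) h)" and t = t and x = x
        and b = "\<lambda>y. lam (y + 1)" and d = nu and A = A and B = "2 * B"
        and c = "fdiff (\<lambda>w. nu w - lam w)"
        and D = "\<lambda>t. fdiff (bd_generator lam nu (\<lambda>z. expect (P t z) h))"])
    show "- (2 * B) \<le> fdiff (\<lambda>y. expect (P s y) h) y" for s y
      using abs_expect_le[where f = h and p = "P s y", OF h(1)]
        abs_expect_le[where f = h and p = "P s (y + 1)", OF h(1)]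
      unfolding fdiff_def by linarith
    show "((\<lambda>s. fdiff (\<lambda>y. expect (P s y) h) y) has_real_derivative
        fdiff (bd_generator lam nu (\<lambda>z. expect (P s z) h)) y) (at_right s)" if "0 \<le> s" for s y
      unfolding fdiff_def by (intro DERIV_diff backward_equation[OF P nu0 h(1)] that)
    show "continuous_on {0..} (\<lambda>s. fdiff (\<lambda>y. expect (P s y) h) y)" for y
      unfolding fdiff_def by (intro continuous_on_diff semigroup_continuous_on[OF P h(1)])
    show "0 \<le> fdiff (\<lambda>y. expect (P 0 y) h) y" for y
      using monoD[OF h(2), of y "y + 1"] by (simp add: expect_semigroup_0[OF P] fdiff_def)
    show "bd_generator (\<lambda>y. lam (y + 1)) nu (fdiff (\<lambda>y. expect (P s y) h)) y
          - fdiff (\<lambda>w. nu w - lam w) y * fdiff (\<lambda>y. expect (P s y) h) y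
        \<le> fdiff (bd_generator lam nu (\<lambda>z. expect (P s z) h)) y" for s y
      by (rule eq_refl[OF generator_intertwining[of nu lam, OF nu0, symmetric]])
  qed (rule pos birth_bounded t curvature)+
qed

text \<open>
  Comparison of \<open>\<partial>P\<^sub>t f\<close> with \<open>e\<^sup>-\<^sup>\<kappa>\<^sup>t P\<^sub>t h\<close>. A majorant \<open>h\<close> of \<open>\<partial>f\<close> is allowed because a bounded
  \<open>f\<close> cannot have nonnegative nondecreasing differences unless it is constant, whereas its differences
  can have a bounded nondecreasing majorant.
\<close>

lemma difference_semigroup_le:
  assumes P: "birth_death_semigroup lam nu P"
    and rates: "irreducible_rates lam nu" and antimono: "antimono lam"
    and \<kappa>: "0 \<le> \<kappa>" and curvature: "\<And>y. \<kappa> \<le> fdiff (\<lambda>w. nu w - lam w) y"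
    and f: "\<And>y. \<bar>f y\<bar> \<le> B"
    and h: "\<And>y. 0 \<le> h y" "\<And>y. h y \<le> B" "mono h"
    and fh: "\<And>y. fdiff f y \<le> h y" and t: "0 \<le> t"
  shows "fdiff (\<lambda>y. expect (P t y) f) x \<le> exp (- \<kappa> * t) * expect (P t x) h"
proof -
  note nu0 = irreducible_ratesD(1)[OF rates] and pos = irreducible_ratesD(2,3)[OF rates]
  have lam0: "lam y \<le> lam 0" for y using antimonoD[OF antimono] by simp
  have curvature0: "0 \<le> fdiff (\<lambda>w. nu w - lam w) y" for y using \<kappa> curvature order_trans by blast
  have h': "\<bar>h y\<bar> \<le> B" for y using h(1,2) by simp
  define F where "F s y = expect (P s y) f" for s y
  define H where "H s y = expect (P s y) h" for s y
  have H_nonneg: "0 \<le> H s y" for s y unfolding H_def using h(1) by (simp add: integral_nonneg)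
  have "0 \<le> exp (- \<kappa> * t) * H t x - fdiff (F t) x"
  proof (rule minimum_principle[where w = "\<lambda>s y. exp (- \<kappa> * s) * H s y - fdiff (F s) y" and t = t and x = x
        and b = "\<lambda>y. lam (y + 1)" and d = nu and A = "lam 0" and B = "2 * B"
        and c = "fdiff (\<lambda>w. nu w - lam w)"
        and D = "\<lambda>s y. exp (- \<kappa> * s) * (bd_generator lam nu (H s) y - \<kappa> * H s y)
                   - fdiff (bd_generator lam nu (F s)) y"])
    show "- (2 * B) \<le> exp (- \<kappa> * s) * H s y - fdiff (F s) y" for s y
    proof -
      have "0 \<le> exp (- \<kappa> * s) * H s y" using H_nonneg by simp
      thus ?thesis
        using abs_expect_le[where f = f and p = "P s y", OF f]
          abs_expect_le[where f = f and p = "P s (y + 1)", OF f]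
        unfolding fdiff_def F_def by linarith
    qed
    show "((\<lambda>s. exp (- \<kappa> * s) * H s y - fdiff (F s) y) has_real_derivative
        exp (- \<kappa> * s) * (bd_generator lam nu (H s) y - \<kappa> * H s y)
        - fdiff (bd_generator lam nu (F s)) y) (at_right s)" if "0 \<le> s" for s y
    proof -
      have F': "((\<lambda>s. F s z) has_real_derivative bd_generator lam nu (F s) z) (at_right s)" for z
        unfolding F_def by (intro backward_equation[OF P nu0 f] that)
      have H': "((\<lambda>s. H s y) has_real_derivative bd_generator lam nu (H s) y) (at_right s)"
        unfolding H_def by (intro backward_equation[OF P nu0 h'] that)
      have exp': "((\<lambda>s. exp (- \<kappa> * s)) has_real_derivative - \<kappa> * exp (- \<kappa> * s)) (at_right s)"
        by (auto intro!: derivative_eq_intros)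
      show ?thesis unfolding fdiff_def
        by (rule DERIV_cong[OF DERIV_diff[OF DERIV_mult[OF exp' H'] DERIV_diff[OF F' F']]])
          (simp add: algebra_simps)
    qed
    show "continuous_on {0..} (\<lambda>s. exp (- \<kappa> * s) * H s y - fdiff (F s) y)" for y
      unfolding fdiff_def H_def F_def
      by (intro continuous_intros semigroup_continuous_on[OF P f] semigroup_continuous_on[OF P h'])
    show "0 \<le> exp (- \<kappa> * 0) * H 0 y - fdiff (F 0) y" for y
      using fh[of y] by (simp add: F_def H_def fdiff_def expect_semigroup_0[OF P])
    show "bd_generator (\<lambda>y. lam (y + 1)) nu (\<lambda>z. exp (- \<kappa> * s) * H s z - fdiff (F s) z) y
          - fdiff (\<lambda>w. nu w - lam w) y * (exp (- \<kappa> * s) * H s y - fdiff (F s) y)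
        \<le> exp (- \<kappa> * s) * (bd_generator lam nu (H s) y - \<kappa> * H s y)
          - fdiff (bd_generator lam nu (F s)) y" if "0 \<le> s" for s y
    proof -
      define E where "E = exp (- \<kappa> * s)"
      define V where "V = fdiff (\<lambda>w. nu w - lam w) y"
      have "0 \<le> fdiff (H s) y"
        unfolding H_def by (rule semigroup_mono[OF P rates lam0 curvature0 h' h(3) that])
      hence "0 \<le> E * ((lam y - lam (y + 1)) * fdiff (H s) y + (V - \<kappa>) * H s y)"
        using antimonoD[OF antimono, of y "y + 1"] curvature[of y] H_nonneg
        unfolding E_def V_def by (intro mult_nonneg_nonneg add_nonneg_nonneg) auto
      \<comment> \<open>Replacing birth rate \<open>\<lambda>\<^sub>y\<close> by \<open>\<lambda>\<^sub>y\<^sub>+\<^sub>1\<close> and killing rate \<open>\<kappa>\<close> by \<open>V\<close> costs exactly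
        the expression just shown to be nonnegative.\<close>
      also have "\<dots> = E * (bd_generator lam nu (H s) y - \<kappa> * H s y)
            - (bd_generator (\<lambda>y. lam (y + 1)) nu (fdiff (F s)) y - V * fdiff (F s) y)
          - (bd_generator (\<lambda>y. lam (y + 1)) nu (\<lambda>z. E * H s z - fdiff (F s) z) y
            - V * (E * H s y - fdiff (F s) y))"
        unfolding bd_generator_def fdiff_def[of "H s"] by algebra
      finally show ?thesis
        unfolding generator_intertwining[of nu lam, OF nu0] E_def V_def by simp
    qed
  qed (rule pos lam0 t curvature0)+
  thus ?thesis unfolding F_def H_def by simp
qed

text \<open>The right-hand side is the expectation of \<open>f\<close> at the sum of the process from \<open>x\<close> and an
  independent Bernoulli variable, because \<open>f + q \<partial>f\<close> with \<open>q = e\<^sup>-\<^sup>\<kappa>\<^sup>t\<close> averages \<open>f(y + 1)\<close> and \<open>f(y)\<close> with weights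
  \<open>q\<close> and \<open>1 - q\<close>. The integrals are taken in \<open>[0, \<infinity>]\<close>, so the truncation at \<open>m\<close> can be
  removed without any moment bound.\<close>

lemma semigroup_convex_step:
  assumes P: "birth_death_semigroup lam nu P"
    and rates: "irreducible_rates lam nu" and antimono: "antimono lam"
    and \<kappa>: "0 \<le> \<kappa>" and curvature: "\<And>y. \<kappa> \<le> fdiff (\<lambda>w. nu w - lam w) y"
    and f: "\<And>y. 0 \<le> f y" "mono f" "\<And>y. 0 \<le> fdiff (fdiff f) y" and t: "0 \<le> t"
  shows "(\<integral>\<^sup>+ y. ennreal (f y) \<partial>P t (x + 1))
    \<le> (\<integral>\<^sup>+ y. ennreal (f y + exp (- \<kappa> * t) * fdiff f y) \<partial>P t x)"
proof -
  define e where "e = exp (- \<kappa> * t)"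
  have e: "0 \<le> e" by (simp add: e_def)
  have f'_nonneg: "0 \<le> fdiff f y" for y using monoD[OF f(2), of y "y + 1"] by (simp add: fdiff_def)
  have f'_mono: "mono (fdiff f)"
    using f(3) unfolding incseq_Suc_iff by (simp add: fdiff_def[of "fdiff f"])
  have truncated: "(\<integral>\<^sup>+ y. ennreal (f (min y m)) \<partial>P t (x + 1))
      \<le> (\<integral>\<^sup>+ y. ennreal (f y + e * fdiff f y) \<partial>P t x)" for m
  proof -
    define g where "g y = f (min y m)" for y
    define h where "h y = fdiff f (min y m)" for y
    define B where "B = max (f m) (fdiff f m)"
    have g0: "0 \<le> g y" and h0: "0 \<le> h y" for y by (simp_all add: g_def h_def f f'_nonneg)
    have "g y \<le> f m" for y unfolding g_def by (intro monoD[OF f(2)]) simp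
    hence gB: "\<bar>g y\<bar> \<le> B" for y using g0 unfolding B_def by (simp add: le_max_iff_disj)
    have "h y \<le> fdiff f m" for y unfolding h_def by (intro monoD[OF f'_mono]) simp
    hence hB: "h y \<le> B" for y unfolding B_def by (simp add: le_max_iff_disj)
    have hB': "\<bar>h y\<bar> \<le> B" for y using h0 hB by simp
    have "mono h" unfolding h_def by (intro monoI monoD[OF f'_mono]) simp
    moreover have "fdiff g y \<le> h y" for y
      using f'_nonneg[of m] by (cases "y < m") (auto simp: fdiff_def g_def h_def min_def le_Suc_eq)
    ultimately have "fdiff (\<lambda>y. expect (P t y) g) x \<le> e * expect (P t x) h"
      unfolding e_def
      by (intro difference_semigroup_le[OF P rates antimono \<kappa> curvature gB h0 hB]) (use t in auto)
    hence "expect (P t (x + 1)) g \<le> expect (P t x) (\<lambda>y. g y + e * h y)"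
      using integrable_bounded_pmf[OF gB] integrable_bounded_pmf[OF hB'] by (simp add: fdiff_def)
    hence "(\<integral>\<^sup>+ y. ennreal (g y) \<partial>P t (x + 1)) \<le> (\<integral>\<^sup>+ y. ennreal (g y + e * h y) \<partial>P t x)"
      using g0 h0 e
      by (subst (1 2) nn_integral_eq_integral)
        (auto intro!: integrable_bounded_pmf[OF gB] integrable_bounded_pmf[OF hB'] ennreal_leI)
    also have "\<dots> \<le> (\<integral>\<^sup>+ y. ennreal (f y + e * fdiff f y) \<partial>P t x)"
      unfolding g_def h_def
      by (intro nn_integral_mono ennreal_leI add_mono mult_left_mono monoD[OF f(2)] monoD[OF f'_mono] e) auto
    finally show ?thesis unfolding g_def .
  qed
  have "(SUP m. ennreal (f (min y m))) = ennreal (f y)" for y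
    by (intro antisym SUP_least SUP_upper2[of y] ennreal_leI monoD[OF f(2)]) auto
  hence "(\<integral>\<^sup>+ y. ennreal (f y) \<partial>P t (x + 1)) = (\<integral>\<^sup>+ y. (SUP m. ennreal (f (min y m))) \<partial>P t (x + 1))"
    by simp
  also have "\<dots> = (SUP m. \<integral>\<^sup>+ y. ennreal (f (min y m)) \<partial>P t (x + 1))"
    by (intro nn_integral_monotone_convergence_SUP)
      (auto intro!: incseq_SucI le_funI ennreal_leI monoD[OF f(2)])
  also have "\<dots> \<le> (\<integral>\<^sup>+ y. ennreal (f y + e * fdiff f y) \<partial>P t x)"
    by (intro SUP_least truncated)
  finally show ?thesis unfolding e_def .
qed

section \<open>From semigroups to random variables\<close>

text \<open>The finite-dimensional Markov property with the two times \<open>0\<close> and \<open>t\<close>; conditioning on the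
  initial value is vacuous since it is almost surely \<open>y\<close>.\<close>

lemma markov_process_distr:
  assumes X: "markov_process P y M X" and t: "0 \<le> t"
  shows "distr M (count_space UNIV) (X t) = measure_pmf (P t y)"
proof (rule measure_eqI_countable[where A = UNIV])
  interpret prob_space M using X by (simp add: markov_process_def)
  have X_meas[measurable]: "X s \<in> measurable M (count_space UNIV)" if "0 \<le> s" for s
    using X that by (simp add: markov_process_def)
  note [measurable] = X_meas[OF t] X_meas[OF order_refl]
  have start: "AE \<omega> in M. X 0 \<omega> = y" using X by (simp add: markov_process_def)
  have "\<P>(\<omega> in M. X 0 \<omega> = y) = 1" using start by (subst prob_Collect_eq_1) auto
  moreover have "\<P>(\<omega> in M. X t \<omega> = z \<and> X 0 \<omega> = y) = \<P>(\<omega> in M. X t \<omega> = z)" for z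
    using start by (intro prob_eq_AE) auto
  moreover have "\<P>(\<omega> in M. X 0 \<omega> = y) \<noteq> 0 \<longrightarrow>
      \<P>(\<omega> in M. X t \<omega> = z \<bar> X 0 \<omega> = y) = pmf (P t y) z" for z
  proof -
    define s where "s k = (if k = 0 then 0 else t)" for k :: nat
    define \<zeta> where "\<zeta> k = (if k = 0 then y else z)" for k :: nat
    have "0 \<le> s 0 \<longrightarrow> (\<forall>k\<le>0. s k \<le> s (Suc k)) \<longrightarrow> \<P>(\<omega> in M. \<forall>k\<le>0. X (s k) \<omega> = \<zeta> k) \<noteq> 0 \<longrightarrow>
        \<P>(\<omega> in M. X (s (Suc 0)) \<omega> = \<zeta> (Suc 0) \<bar> \<forall>k\<le>0. X (s k) \<omega> = \<zeta> k)
          = pmf (P (s (Suc 0) - s 0) (\<zeta> 0)) (\<zeta> (Suc 0))"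
      using X unfolding markov_process_def by blast
    thus ?thesis using t by (simp add: s_def \<zeta>_def)
  qed
  ultimately have "\<P>(\<omega> in M. X t \<omega> = z) = pmf (P t y) z" for z
    by (simp add: cond_prob_def)
  thus "emeasure (distr M (count_space UNIV) (X t)) {z} = emeasure (measure_pmf (P t y)) {z}" for z
    by (simp add: emeasure_distr emeasure_pmf_single emeasure_eq_measure vimage_def Int_def conj_commute)
qed auto

lemma (in prob_space) nn_integral_add_indep_bernoulli:
  fixes Z Y :: "'a \<Rightarrow> nat" and g :: "nat \<Rightarrow> ennreal"
  assumes indep: "indep_var (count_space UNIV) Z (count_space UNIV) Y"
    and Z: "distr M (count_space UNIV) Z = measure_pmf p"
    and Y: "distr M (count_space UNIV) Y = measure_pmf (map_pmf of_bool (bernoulli_pmf q))"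
    and q: "0 \<le> q" "q \<le> 1"
  shows "(\<integral>\<^sup>+ \<omega>. g (Z \<omega> + Y \<omega>) \<partial>M) = (\<integral>\<^sup>+ z. g (z + 1) * q + g z * (1 - q) \<partial>p)"
proof -
  let ?N = "count_space (UNIV :: nat set)"
  have [measurable]: "Z \<in> measurable M ?N" "Y \<in> measurable M ?N"
    and joint: "distr M ?N Z \<Otimes>\<^sub>M distr M ?N Y = distr M (?N \<Otimes>\<^sub>M ?N) (\<lambda>\<omega>. (Z \<omega>, Y \<omega>))"
    using indep unfolding indep_var_distribution_eq by auto
  have "(\<integral>\<^sup>+ \<omega>. g (Z \<omega> + Y \<omega>) \<partial>M)
      = (\<integral>\<^sup>+ zy. g (fst zy + snd zy) \<partial>distr M (?N \<Otimes>\<^sub>M ?N) (\<lambda>\<omega>. (Z \<omega>, Y \<omega>)))"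
    by (subst nn_integral_distr) auto
  also have "\<dots> = (\<integral>\<^sup>+ z. \<integral>\<^sup>+ y. g (z + y) \<partial>map_pmf of_bool (bernoulli_pmf q) \<partial>p)"
    unfolding joint[symmetric] Z Y
    by (subst measure_pmf.nn_integral_fst[symmetric]) auto
  also have "\<dots> = (\<integral>\<^sup>+ z. g (z + 1) * q + g z * (1 - q) \<partial>p)"
    using q by simp
  finally show ?thesis .
qed

section \<open>Convex domination\<close>

theorem corollary3p16:
  fixes lam nu :: "nat \<Rightarrow> real"
    and \<kappa> t :: real
    and x :: nat
    and P1 :: "real \<Rightarrow> nat \<Rightarrow> nat pmf"
    and M :: "'a measure" and X :: "real \<Rightarrow> 'a \<Rightarrow> nat"
    and N :: "'b measure" and X' :: "real \<Rightarrow> 'b \<Rightarrow> nat" and Y :: "'b \<Rightarrow> nat"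
  assumes irreducible: "irreducible_rates lam nu"
    and nonexplosive: "nonexplosive_rates lam nu"
    and P1: "birth_death_semigroup (\<lambda>y. lam (y + 1)) nu P1"
    and P1_finite: "\<And>y s. 0 \<le> s \<Longrightarrow>
          semigroup_apply P1 s
            (\<lambda>z. lam (z + 1) + nu z + \<bar>fdiff (\<lambda>w. nu w - lam w) z\<bar>) y < \<infinity>"
    and lam_nonincreasing: "antimono lam"
    and kappa_nonneg: "0 \<le> \<kappa>"
    and kappa_bound: "\<And>y. \<kappa> \<le> fdiff (\<lambda>w. nu w - lam w) y"
    and t_nonneg: "0 \<le> t"
    and X: "birth_death_process lam nu (x + 1) M X"
    and X': "birth_death_process lam nu x N X'"
    and Y_bernoulli:
      "distr N (count_space UNIV) Y
         = measure_pmf (map_pmf of_bool (bernoulli_pmf (exp (- \<kappa> * t))))"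
    and Y_indep:
      "prob_space.indep_var N (count_space UNIV) (X' t) (count_space UNIV) Y"
  shows "convex_dominated M (X t) N (\<lambda>\<omega>. X' t \<omega> + Y \<omega>)"
proof -
  have lam0: "lam y \<le> lam 0" for y using antimonoD[OF lam_nonincreasing] by simp
  obtain P where P: "birth_death_semigroup lam nu P" "markov_process P (x + 1) M X"
    using X unfolding birth_death_process_def by blast
  obtain P' where P': "birth_death_semigroup lam nu P'" "markov_process P' x N X'"
    using X' unfolding birth_death_process_def by blast
  interpret N: prob_space N using P'(2) by (simp add: markov_process_def)
  have law: "distr M (count_space UNIV) (X t) = measure_pmf (P t (x + 1))"
    by (rule markov_process_distr[OF P(2) t_nonneg])
  have law': "distr N (count_space UNIV) (X' t) = measure_pmf (P t x)"
    unfolding semigroup_unique[OF P(1) P'(1) irreducible lam0 t_nonneg]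
    by (rule markov_process_distr[OF P'(2) t_nonneg])
  have [measurable]: "X t \<in> measurable M (count_space UNIV)"
    using P(2) t_nonneg by (simp add: markov_process_def)
  define q where "q = exp (- \<kappa> * t)"
  have q: "0 \<le> q" "q \<le> 1" using kappa_nonneg t_nonneg by (auto simp: q_def)
  show ?thesis
    unfolding convex_dominated_def
  proof (intro allI impI)
    fix f :: "nat \<Rightarrow> real"
    assume f: "\<forall>x. 0 \<le> f x" "mono f" "\<forall>x. 0 \<le> fdiff (fdiff f) x"
    have "(\<integral>\<^sup>+ \<omega>. ennreal (f (X t \<omega>)) \<partial>M) = (\<integral>\<^sup>+ y. ennreal (f y) \<partial>P t (x + 1))"
      unfolding law[symmetric] by (subst nn_integral_distr) auto
    also have "\<dots> \<le> (\<integral>\<^sup>+ y. ennreal (f y + q * fdiff f y) \<partial>P t x)"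
      unfolding q_def using f
      by (intro semigroup_convex_step[OF P(1) irreducible lam_nonincreasing kappa_nonneg
            kappa_bound _ _ _ t_nonneg]) auto
    also have "\<dots> = (\<integral>\<^sup>+ y. ennreal (f (y + 1)) * q + ennreal (f y) * (1 - q) \<partial>P t x)"
    proof (intro nn_integral_cong)
      fix y
      have "f y + q * fdiff f y = f (y + 1) * q + f y * (1 - q)"
        by (simp add: fdiff_def algebra_simps)
      thus "ennreal (f y + q * fdiff f y) = ennreal (f (y + 1)) * q + ennreal (f y) * (1 - q)"
        using f(1) q by (simp add: ennreal_mult ennreal_plus ennreal_minus)
    qed
    also have "\<dots> = (\<integral>\<^sup>+ \<omega>. ennreal (f (X' t \<omega> + Y \<omega>)) \<partial>N)"
      by (rule N.nn_integral_add_indep_bernoulli[symmetric, OF Y_indep law' _ q])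
        (simp add: Y_bernoulli q_def)
    finally show "(\<integral>\<^sup>+ \<omega>. ennreal (f (X t \<omega>)) \<partial>M) \<le> (\<integral>\<^sup>+ \<omega>. ennreal (f (X' t \<omega> + Y \<omega>)) \<partial>N)" .
  qed
qed

end
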